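(* For $\mathsf S\in\{\mathsf T,\mathsf F\}$, the relation $\{(\varphi,\psi)\in\mathsf{Form}\times\mathsf{Form}\mid\varphi\vdash_{\mathsf S}\psi\}$ is decidable.
   Context: **Language.** $\mathsf{Prop}=\{p_0,p_1,\dots\}$ is a countable set of propositional variables; $\mathsf{Form}$ is generated by $\varphi::=p\mid\bot\mid\top\mid(\varphi\wedge\varphi)\mid(\varphi\vee\varphi)\mid(\varphi\to\varphi)$, $p\in\mathsf{Prop}$, and $\neg\alpha:=\alpha\to\bot$. **Systems.** For relations ${\vdash}\subseteq\wp(\mathsf{Form})\times\mathsf{Form}$ write $\Gamma,\varphi\vdash\psi$ for $\Gamma\cup\{\varphi\}\vdash\psi$, $\varphi\vdash\psi$ for $\{\varphi\}\vdash\psi$, $\vdash\varphi$ for $\varnothing\vdash\varphi$, and $\alpha\dashv\vdash\beta$ for $\alpha\vdash\beta$ and $\beta\vdash\alpha$. The *$\mathsf K$-conditions* are, for all sets $\Gamma,\Delta$ and formulas: (A) $\Gamma,\varphi\vdash\varphi$; (Cut) if $\Gamma,\psi\vdash\varphi$ and $\Delta\vdash\psi$ then $\Gamma\cup\Delta\vdash\varphi$; ($\wedge$I) $\{\varphi,\psi\}\vdash\varphi\wedge\psi$; ($\wedge$E) $\varphi\wedge\psi\vdash\varphi$ and $\varphi\wedge\psi\vdash\psi$; ($\vee$I) $\varphi\vdash\varphi\vee\psi$ and $\psi\vdash\varphi\vee\psi$; ($\vee$E) if $\varphi\vdash\alpha$ and $\psi\vdash\alpha$ then $\varphi\vee\psi\vdash\alpha$;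 ($\bot$E) $\bot\vdash\varphi$; ($\top$) $\vdash\top$; ($\top\to$E) $\top\to\varphi\vdash\varphi$; (Con) if $\alpha\wedge\beta\vdash\psi$ then $\alpha\to\beta\vdash\alpha\to\psi$; ($\wedge{\vdash}\to$) $\alpha\wedge\beta\vdash\alpha\to\beta$; (Imp) if $\alpha\wedge\beta\vdash\varphi$ then $\varphi\to(\alpha\to\beta)\vdash(\varphi\wedge\alpha)\to\beta$; (Rep) if $\alpha\dashv\vdash\alpha'$ then $\alpha\to\beta\dashv\vdash\alpha'\to\beta$. $\vdash_{\mathsf T}$ is the smallest relation satisfying the $\mathsf K$-conditions together with ($\to$Id) $\vdash\alpha\to\alpha$ and (Exp) $\{\alpha,\neg\alpha\}\vdash\bot$. $\vdash_{\mathsf F}$ is the smallest relation satisfying all of these together with ($\neg\neg$I) $\alpha\vdash\neg\neg\alpha$. *)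

theory Defs
  imports "HOL-Library.Nat_Bijection"
begin

section \<open>Formulas and the two systems\<close>

datatype form =
    Var nat
  | Bot  ("\<^bold>\<bottom>")
  | Top  ("\<^bold>\<top>")
  | Conj form form  (infixr "\<^bold>\<and>" 75)
  | Disj form form  (infixr "\<^bold>\<or>" 70)
  | Imp form form   (infixr "\<^bold>\<rightarrow>" 65)

abbreviation Neg :: "form \<Rightarrow> form"  ("\<^bold>\<not> _" [80] 80)
  where "\<^bold>\<not> \<alpha> \<equiv> \<alpha> \<^bold>\<rightarrow> \<^bold>\<bottom>"

datatype system = SysT | SysF

text \<open>
  Sets of premises are arbitrary, possibly infinite. The last rule is available in the
  system \<open>SysF\<close> only; all the other rules belong to both systems.
\<close>

inductive derives :: "system \<Rightarrow> form set \<Rightarrow> form \<Rightarrow> bool"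
  for S :: system
  where
    A:       "derives S (insert \<phi> \<Gamma>) \<phi>"
  | Cut:     "derives S (insert \<psi> \<Gamma>) \<phi> \<Longrightarrow> derives S \<Delta> \<psi> \<Longrightarrow> derives S (\<Gamma> \<union> \<Delta>) \<phi>"
  | ConjI:   "derives S {\<phi>, \<psi>} (\<phi> \<^bold>\<and> \<psi>)"
  | ConjE1:  "derives S {\<phi> \<^bold>\<and> \<psi>} \<phi>"
  | ConjE2:  "derives S {\<phi> \<^bold>\<and> \<psi>} \<psi>"
  | DisjI1:  "derives S {\<phi>} (\<phi> \<^bold>\<or> \<psi>)"
  | DisjI2:  "derives S {\<psi>} (\<phi> \<^bold>\<or> \<psi>)"
  | DisjE:   "derives S {\<phi>} \<alpha> \<Longrightarrow> derives S {\<psi>} \<alpha> \<Longrightarrow> derives S {\<phi> \<^bold>\<or> \<psi>} \<alpha>"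
  | BotE:    "derives S {\<^bold>\<bottom>} \<phi>"
  | TopI:    "derives S {} \<^bold>\<top>"
  | TopImpE: "derives S {\<^bold>\<top> \<^bold>\<rightarrow> \<phi>} \<phi>"
  | Con:     "derives S {\<alpha> \<^bold>\<and> \<beta>} \<psi> \<Longrightarrow> derives S {\<alpha> \<^bold>\<rightarrow> \<beta>} (\<alpha> \<^bold>\<rightarrow> \<psi>)"
  | ConjImp: "derives S {\<alpha> \<^bold>\<and> \<beta>} (\<alpha> \<^bold>\<rightarrow> \<beta>)"
  | ImpR:    "derives S {\<alpha> \<^bold>\<and> \<beta>} \<phi> \<Longrightarrow>
                derives S {\<phi> \<^bold>\<rightarrow> (\<alpha> \<^bold>\<rightarrow> \<beta>)} ((\<phi> \<^bold>\<and> \<alpha>) \<^bold>\<rightarrow> \<beta>)"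
  | Rep1:    "derives S {\<alpha>} \<alpha>' \<Longrightarrow> derives S {\<alpha>'} \<alpha> \<Longrightarrow>
                derives S {\<alpha> \<^bold>\<rightarrow> \<beta>} (\<alpha>' \<^bold>\<rightarrow> \<beta>)"
  | Rep2:    "derives S {\<alpha>} \<alpha>' \<Longrightarrow> derives S {\<alpha>'} \<alpha> \<Longrightarrow>
                derives S {\<alpha>' \<^bold>\<rightarrow> \<beta>} (\<alpha> \<^bold>\<rightarrow> \<beta>)"
  | ImpId:   "derives S {} (\<alpha> \<^bold>\<rightarrow> \<alpha>)"
  | Exp:     "derives S {\<alpha>, \<^bold>\<not> \<alpha>} \<^bold>\<bottom>"
  | NegNegI: "S = SysF \<Longrightarrow> derives S {\<alpha>} (\<^bold>\<not> (\<^bold>\<not> \<alpha>))"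

abbreviation derives_infix :: "form set \<Rightarrow> system \<Rightarrow> form \<Rightarrow> bool"
    ("(_ \<turnstile>\<^bsub>_\<^esub> _)" [51, 0, 51] 50)
  where "\<Gamma> \<turnstile>\<^bsub>S\<^esub> \<phi> \<equiv> derives S \<Gamma> \<phi>"


section \<open>Partial recursive functions\<close>

datatype recf =
    Zero
  | Succ
  | Proj nat
  | Comp recf "recf list"
  | PrimRec recf recf
  | Mu recf

text \<open>
  \<open>evaluates r xs y\<close>: the Kleene partial recursive function denoted by \<open>r\<close> is defined at
  the argument tuple \<open>xs\<close>, with value \<open>y\<close>. The recursion variable of \<open>PrimRec\<close> and
  the search variable of \<open>Mu\<close> come first in the tuple. The minimisation \<open>Mu f\<close> is
  defined only if \<open>f\<close> is defined, with nonzero value, at every candidate below the result.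
\<close>

inductive evaluates :: "recf \<Rightarrow> nat list \<Rightarrow> nat \<Rightarrow> bool"
  where
    Zero: "evaluates Zero xs 0"
  | Succ: "evaluates Succ [x] (Suc x)"
  | Proj: "i < length xs \<Longrightarrow> evaluates (Proj i) xs (xs ! i)"
  | Comp: "list_all2 (\<lambda>g y. evaluates g xs y) gs ys \<Longrightarrow> evaluates f ys z \<Longrightarrow>
             evaluates (Comp f gs) xs z"
  | PrimRec_0: "evaluates f xs y \<Longrightarrow> evaluates (PrimRec f g) (0 # xs) y"
  | PrimRec_Suc: "evaluates (PrimRec f g) (n # xs) r \<Longrightarrow> evaluates g (n # r # xs) y \<Longrightarrow>
             evaluates (PrimRec f g) (Suc n # xs) y"
  | Mu: "(\<forall>i<n. \<exists>k. evaluates f (i # xs) (Suc k)) \<Longrightarrow> evaluates f (n # xs) 0 \<Longrightarrow>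
             evaluates (Mu f) xs n"

lemma evaluates_functional:
  "evaluates r xs y \<Longrightarrow> evaluates r xs y' \<Longrightarrow> y = y'"
proof (induction arbitrary: y' rule: evaluates.induct)
  case (Comp xs gs ys f z)
  from Comp.prems obtain ys' where
    ys': "list_all2 (\<lambda>g y. evaluates g xs y) gs ys'" "evaluates f ys' y'"
    by (auto elim: evaluates.cases)
  have "ys = ys'"
    using Comp.IH(1) ys'(1) by (auto simp: list_all2_conv_all_nth intro!: nth_equalityI)
  then show ?case using Comp.IH(2) ys'(2) by blast
next
  case (Mu n f xs)
  from Mu.prems have m: "\<forall>i<y'. \<exists>k. evaluates f (i # xs) (Suc k)" "evaluates f (y' # xs) 0"
    by (auto elim: evaluates.cases)
  show ?case
  proof (cases n y' rule: linorder_cases)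
    case less
    then obtain k where "evaluates f (n # xs) (Suc k)" using m(1) by blast
    then show ?thesis using Mu.IH(2) by fastforce
  next
    case greater
    then show ?thesis using Mu.IH(1) m(2) by fastforce
  qed
next
  case (PrimRec_0 f xs y g)
  from PrimRec_0.prems have "evaluates f xs y'" by (auto elim: evaluates.cases)
  then show ?case by (rule PrimRec_0.IH)
next
  case (PrimRec_Suc f g n xs r y)
  from PrimRec_Suc.prems obtain r' where
    "evaluates (PrimRec f g) (n # xs) r'" "evaluates g (n # r' # xs) y'"
    by (auto elim: evaluates.cases)
  then show ?case using PrimRec_Suc.IH by blast
qed (auto elim: evaluates.cases)


section \<open>Decidable relations between formulas\<close>

text \<open>
  An effective Goedel numbering, based on the Cantor pairing function. Every natural
  number is the code of exactly one formula.
\<close>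

fun code :: "form \<Rightarrow> nat"
  where
    "code \<^bold>\<bottom> = 0"
  | "code \<^bold>\<top> = 1"
  | "code (Var n) = 4 * n + 2"
  | "code (\<phi> \<^bold>\<and> \<psi>) = 4 * prod_encode (code \<phi>, code \<psi>) + 3"
  | "code (\<phi> \<^bold>\<or> \<psi>) = 4 * prod_encode (code \<phi>, code \<psi>) + 4"
  | "code (\<phi> \<^bold>\<rightarrow> \<psi>) = 4 * prod_encode (code \<phi>, code \<psi>) + 5"

lemma inj_code: "inj code"
proof (rule injI)
  show "code \<phi> = code \<psi> \<Longrightarrow> \<phi> = \<psi>" for \<phi> \<psi>
  proof (induction \<phi> arbitrary: \<psi>)
    case Bot then show ?case by (cases \<psi>) auto
  next
    case Top then show ?case by (cases \<psi>) auto
  next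
    case (Var n) then show ?case by (cases \<psi>) (auto, presburger+)
  next
    case (Conj \<phi>1 \<phi>2) then show ?case by (cases \<psi>) (auto, presburger+)
  next
    case (Disj \<phi>1 \<phi>2) then show ?case by (cases \<psi>) (auto, presburger+)
  next
    case (Imp \<phi>1 \<phi>2) then show ?case by (cases \<psi>) (auto, presburger+)
  qed
qed

lemma surj_code: "surj code"
proof -
  have "\<exists>\<phi>. code \<phi> = n" for n
  proof (induction n rule: less_induct)
    case (less n)
    show ?case
    proof (cases "n < 2")
      case True
      then have "n = code \<^bold>\<bottom> \<or> n = code \<^bold>\<top>" by auto
      then show ?thesis by metis
    next
      case False
      define m where "m = (n - 2) div 4"
      obtain a b where ab: "m = prod_encode (a, b)"
        by (metis prod_decode_inverse surj_pair)
      have "m < n" using False by (auto simp: m_def)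
      then have "a < n" "b < n"
        using ab le_prod_encode_1[of a b] le_prod_encode_2[of b a] by auto
      then obtain \<phi> \<psi> where "code \<phi> = a" "code \<psi> = b" using less.IH by metis
      moreover have "n = 4 * m + 2 \<or> n = 4 * m + 3 \<or> n = 4 * m + 4 \<or> n = 4 * m + 5"
        using False unfolding m_def by presburger
      ultimately have "n = code (Var m) \<or> n = code (\<phi> \<^bold>\<and> \<psi>) \<or> n = code (\<phi> \<^bold>\<or> \<psi>)
          \<or> n = code (\<phi> \<^bold>\<rightarrow> \<psi>)"
        using ab by auto
      then show ?thesis by metis
    qed
  qed
  then show ?thesis by (metis surjI)
qed

definition decidable :: "(form \<times> form) set \<Rightarrow> bool"
  where "decidable R \<longleftrightarrow>
    (\<exists>r. \<forall>\<phi> \<psi>. evaluates r [code \<phi>, code \<psi>] (if (\<phi>, \<psi>) \<in> R then 1 else 0))"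

end

theory Submission
  imports Defs
begin

text \<open>
  Both systems are sound and complete for a relational semantics with a finite model property of
  explicit, polynomial size. In a frame with relation \<open>R\<close>, where \<open>R y x\<close> is read as ``\<open>x\<close> is open to
  \<open>y\<close>'', a formula denotes a set of points; \<open>\<alpha> \<rightarrow> \<beta>\<close> holds at \<open>x\<close> if every \<open>\<alpha>\<close>-point \<open>y\<close>
  with \<open>R y x\<close> has a point \<open>z\<close> with \<open>R y z\<close> at which \<open>\<alpha>\<close> and \<open>\<beta>\<close> hold. The sets denoted
  are fixpoints of the closure operator \<open>A \<mapsto> \<top> \<rightarrow> A\<close>, and a disjunction is the closure of a
  union. Reflexivity of \<open>R\<close> validates \<open>\<alpha> \<rightarrow> \<alpha>\<close> and explosion, and a weak form of symmetry adds
  double negation introduction.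

  Completeness is obtained relative to a finite set \<open>F\<close> of formulas that is closed under
  subformulas and contains \<open>\<bottom>\<close> and \<open>\<top>\<close>. The points of the canonical frame are pairs
  \<open>(\<gamma>, \<kappa>)\<close> such that \<open>\<gamma> \<turnstile> \<gamma> \<rightarrow> \<kappa>\<close> fails, where \<open>\<kappa>\<close> is in \<open>F\<close> and \<open>\<gamma>\<close> is in
  \<open>F\<close> or is a conjunction of two members of \<open>F\<close>. Intuitively \<open>\<gamma>\<close> is what the point asserts and
  \<open>\<gamma> \<rightarrow> \<kappa>\<close> is what it rejects, and \<open>x\<close> is open to \<open>y\<close> if \<open>x\<close> does not assert what \<open>y\<close>
  rejects. Then a member of \<open>F\<close> holds at \<open>(\<gamma>, \<kappa>)\<close> exactly if \<open>\<gamma>\<close> derives it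
  (\<open>truth_lemma\<close>); the step for implication (\<open>canon_arrow\<close>) only needs the conjunction of antecedent
  and consequent, so no larger meets are needed as first components. Hence an underivable
  sequent fails in a frame whose size is bounded by a cubic polynomial in the size of \<open>F\<close>
  (\<open>finite_model_property\<close>).

  For \<open>F\<close> one can take all formulas whose code lies below a bound \<open>L\<close>. A finite frame and the
  table of truth values of the members of \<open>F\<close> are then two finite binary relations on numbers,
  each of which is coded by a number below an explicit bound. So derivability is defined by a
  formula of arithmetic all of whose quantifiers are bounded
  (\<open>derives_iff_no_coded_countermodel\<close>), and such predicates are decided by recursive functions.
\<close>


section \<open>Frames\<close>

text \<open>
  The operation on sets of points that interprets implication. With the full set of points in
  place of \<open>P\<close> it is a closure operator; variables and disjunctions use this instance.
\<close>

definition arrow :: "'w set \<Rightarrow> ('w \<Rightarrow> 'w \<Rightarrow> bool) \<Rightarrow> ('w \<Rightarrow> bool) \<Rightarrow> ('w \<Rightarrow> bool) \<Rightarrow> 'w \<Rightarrow> bool"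
  where "arrow X R P Q x \<longleftrightarrow>
    (\<forall>y\<in>X. R y x \<longrightarrow> P y \<longrightarrow> (\<exists>z\<in>X. R y z \<and> P z \<and> Q z))"

text \<open>
  The condition for \<open>SysF\<close> is known as pseudosymmetry: if \<open>x\<close> is open to \<open>y\<close>, then \<open>y\<close> is open to
  some \<open>z\<close> that is itself open only to points to which \<open>x\<close> is open. Every closed set that contains
  \<open>x\<close> then contains \<open>z\<close>.
\<close>

definition frame :: "system \<Rightarrow> 'w set \<Rightarrow> ('w \<Rightarrow> 'w \<Rightarrow> bool) \<Rightarrow> bool"
  where "frame S X R \<longleftrightarrow> (\<forall>x\<in>X. R x x) \<and>
    (S = SysF \<longrightarrow>
      (\<forall>x\<in>X. \<forall>y\<in>X. R y x \<longrightarrow> (\<exists>z\<in>X. R z y \<and> (\<forall>w\<in>X. R w z \<longrightarrow> R w x))))"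

text \<open>
  A variable is interpreted by the closure of its value, so that a valuation may assign arbitrary
  sets of points and still every formula denotes a closed set.
\<close>

primrec sat :: "'w set \<Rightarrow> ('w \<Rightarrow> 'w \<Rightarrow> bool) \<Rightarrow> (nat \<Rightarrow> 'w \<Rightarrow> bool) \<Rightarrow> form \<Rightarrow> 'w \<Rightarrow> bool"
  where
    "sat X R V (Var p) = arrow X R (\<lambda>_. True) (V p)"
  | "sat X R V \<^bold>\<bottom> = (\<lambda>_. False)"
  | "sat X R V \<^bold>\<top> = (\<lambda>_. True)"
  | "sat X R V (\<phi> \<^bold>\<and> \<psi>) = (\<lambda>x. sat X R V \<phi> x \<and> sat X R V \<psi> x)"
  | "sat X R V (\<phi> \<^bold>\<or> \<psi>) = arrow X R (\<lambda>_. True) (\<lambda>z. sat X R V \<phi> z \<or> sat X R V \<psi> z)"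
  | "sat X R V (\<phi> \<^bold>\<rightarrow> \<psi>) = arrow X R (sat X R V \<phi>) (sat X R V \<psi>)"

lemma arrow_closed:
  "x \<in> X \<Longrightarrow> arrow X R (\<lambda>_. True) (arrow X R P Q) x \<Longrightarrow> arrow X R P Q x"
  unfolding arrow_def by meson

lemma sat_closed:
  assumes "frame S X R" "x \<in> X" "arrow X R (\<lambda>_. True) (sat X R V \<phi>) x"
  shows "sat X R V \<phi> x"
  using assms(2,3)
proof (induction \<phi>)
  case Bot
  then show ?case using assms(1) unfolding arrow_def frame_def by auto
next
  case (Conj \<phi> \<psi>)
  then show ?case unfolding arrow_def sat.simps by meson
qed (auto intro: arrow_closed)

lemma sat_iff_closed:
  assumes "frame S X R" "x \<in> X"
  shows "arrow X R (\<lambda>_. True) (sat X R V \<phi>) x \<longleftrightarrow> sat X R V \<phi> x"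
  using sat_closed[OF assms] assms(2) unfolding arrow_def by blast

text \<open>
  Most rules hold in every relational structure. Closedness of the conclusion is what
  makes disjunction elimination and the elimination of \<open>\<top> \<rightarrow> \<phi>\<close> sound, reflexivity is used for
  \<open>\<alpha> \<rightarrow> \<alpha>\<close>, for explosion and for the closedness of the empty set, and pseudosymmetry for
  double negation introduction.
\<close>

theorem soundness:
  assumes "derives S \<Gamma> \<phi>" "frame S X R" "x \<in> X" "\<forall>\<gamma>\<in>\<Gamma>. sat X R V \<gamma> x"
  shows "sat X R V \<phi> x"
  using assms(1,3,4)
proof (induction arbitrary: x rule: derives.induct)
  case (DisjE \<phi> \<alpha> \<psi>)
  have "arrow X R (\<lambda>_. True) (\<lambda>z. sat X R V \<phi> z \<or> sat X R V \<psi> z) x"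
    using DisjE.prems(2) by simp
  moreover have "sat X R V \<alpha> z" if "z \<in> X" "sat X R V \<phi> z \<or> sat X R V \<psi> z" for z
    using that DisjE.IH by auto
  ultimately have "arrow X R (\<lambda>_. True) (sat X R V \<alpha>) x"
    unfolding arrow_def by meson
  then show ?case by (rule sat_closed[OF assms(2) DisjE.prems(1)])
next
  case (TopImpE \<phi>)
  then have "arrow X R (\<lambda>_. True) (sat X R V \<phi>) x" by simp
  then show ?case by (rule sat_closed[OF assms(2) TopImpE.prems(1)])
next
  case (ImpR \<alpha> \<beta> \<phi>)
  from ImpR.IH have sub: "sat X R V \<phi> w" if "w \<in> X" "sat X R V \<alpha> w" "sat X R V \<beta> w" for w
    using that by simp
  from ImpR.prems sub show ?case by (simp add: arrow_def) meson
next
  case (Exp \<alpha>)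
  then show ?case using assms(2) unfolding frame_def by (auto simp: arrow_def)
next
  case (NegNegI \<alpha>)
  show ?case
  proof (simp add: arrow_def, intro ballI impI)
    fix y assume y: "y \<in> X" "R y x"
    then obtain z where z: "z \<in> X" "R z y" "\<forall>w\<in>X. R w z \<longrightarrow> R w x"
      using assms(2) NegNegI.hyps NegNegI.prems(1) unfolding frame_def by meson
    have "sat X R V \<alpha> x" using NegNegI.prems(2) by simp
    then have "arrow X R (\<lambda>_. True) (sat X R V \<alpha>) z"
      using z NegNegI.prems(1) unfolding arrow_def by meson
    then have "sat X R V \<alpha> z" by (rule sat_closed[OF assms(2) z(1)])
    then show "\<exists>z\<in>X. R z y \<and> sat X R V \<alpha> z" using z by blast
  qed
next
  case (Con \<alpha> \<beta> \<psi>)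
  from Con.IH have "sat X R V \<psi> w" if "w \<in> X" "sat X R V \<alpha> w" "sat X R V \<beta> w" for w
    using that by simp
  with Con.prems(2) show ?case by (simp add: arrow_def) meson
next
  case (Rep1 \<alpha> \<alpha>' \<beta>)
  from Rep1.IH have "sat X R V \<alpha> w \<longleftrightarrow> sat X R V \<alpha>' w" if "w \<in> X" for w
    using that by auto
  with Rep1.prems(2) show ?case by (simp add: arrow_def)
next
  case (Rep2 \<alpha> \<alpha>' \<beta>)
  from Rep2.IH have "sat X R V \<alpha> w \<longleftrightarrow> sat X R V \<alpha>' w" if "w \<in> X" for w
    using that by auto
  with Rep2.prems(2) show ?case by (simp add: arrow_def)
next
  case (ImpId \<alpha>)
  then show ?case using assms(2) unfolding frame_def by (auto simp: arrow_def)
next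
  case (Cut \<psi> \<Gamma> \<phi> \<Delta>)
  then show ?case by (simp add: ball_Un)
qed (auto simp: arrow_def)

text \<open>
  Points of \<open>Y\<close> with the same image are indistinguishable in the pulled-back frame, so that \<open>f\<close> is
  a surjective bisimulation.
\<close>

lemma sat_pullback:
  assumes "f ` Y = X" "y \<in> Y"
  shows "sat Y (\<lambda>u v. R (f u) (f v)) (\<lambda>p u. V p (f u)) \<phi> y \<longleftrightarrow> sat X R V \<phi> (f y)"
  using assms(2)
proof (induction \<phi> arbitrary: y)
qed (auto simp: arrow_def assms(1)[symmetric])

lemma frame_pullback:
  assumes "f ` Y = X" "frame S X R"
  shows "frame S Y (\<lambda>u v. R (f u) (f v))"
  using assms(2) unfolding frame_def assms(1)[symmetric] by simp


section \<open>Derivability as a preorder\<close>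

lemma entails_refl: "derives S {\<alpha>} \<alpha>"
  using derives.A by blast

lemma entails_trans: "derives S {\<alpha>} \<beta> \<Longrightarrow> derives S {\<beta>} \<gamma> \<Longrightarrow> derives S {\<alpha>} \<gamma>"
  using derives.Cut[of S \<beta> "{}" \<gamma> "{\<alpha>}"] by simp

lemma entails_theorem:
  assumes "derives S {} \<beta>"
  shows "derives S {\<alpha>} \<beta>"
proof -
  have "derives S (insert \<beta> {\<alpha>}) \<beta>" by (rule derives.A)
  from derives.Cut[OF this assms] show ?thesis by simp
qed

lemma entails_two:
  assumes "derives S {\<alpha>, \<beta>} \<delta>" "derives S {\<gamma>} \<alpha>" "derives S {\<gamma>} \<beta>"
  shows "derives S {\<gamma>} \<delta>"
proof -
  have "derives S {\<beta>, \<gamma>} \<delta>" using derives.Cut[OF assms(1,2)] by (simp add: insert_commute)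
  from derives.Cut[OF this assms(3)] show ?thesis by simp
qed

lemmas entails_conj = entails_two[OF derives.ConjI]

lemma entails_conjD1: "derives S {\<alpha>} (\<beta> \<^bold>\<and> \<gamma>) \<Longrightarrow> derives S {\<alpha>} \<beta>"
  by (rule entails_trans[OF _ derives.ConjE1])

lemma entails_conjD2: "derives S {\<alpha>} (\<beta> \<^bold>\<and> \<gamma>) \<Longrightarrow> derives S {\<alpha>} \<gamma>"
  by (rule entails_trans[OF _ derives.ConjE2])

lemma entails_contradiction:
  "derives S {\<alpha>} (\<^bold>\<not> \<alpha>) \<Longrightarrow> derives S {\<alpha>} \<beta>"
  by (rule entails_trans[OF entails_two[OF derives.Exp entails_refl] derives.BotE])

lemma top_imp_iff: "derives S {\<alpha>} (\<^bold>\<top> \<^bold>\<rightarrow> \<beta>) \<longleftrightarrow> derives S {\<alpha>} \<beta>"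
proof
  assume "derives S {\<alpha>} (\<^bold>\<top> \<^bold>\<rightarrow> \<beta>)"
  then show "derives S {\<alpha>} \<beta>" by (rule entails_trans[OF _ derives.TopImpE])
next
  assume "derives S {\<alpha>} \<beta>"
  then have "derives S {\<alpha>} (\<^bold>\<top> \<^bold>\<and> \<beta>)"
    by (rule entails_conj[OF entails_theorem[OF derives.TopI]])
  then show "derives S {\<alpha>} (\<^bold>\<top> \<^bold>\<rightarrow> \<beta>)" by (rule entails_trans[OF _ derives.ConjImp])
qed

text \<open>
  The form in which the rule \<open>ImpR\<close> enters the completeness proof. By the first hypothesis
  \<open>\<alpha> \<rightarrow> \<beta>\<close> entails \<open>\<alpha> \<rightarrow> (\<epsilon> \<rightarrow> \<kappa>)\<close> and hence \<open>(\<alpha> \<and> \<epsilon>) \<rightarrow> \<kappa>\<close>, whose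
  antecedent is equivalent to \<open>\<epsilon>\<close>.
\<close>

lemma imp_absorb:
  assumes "derives S {\<alpha> \<^bold>\<and> \<beta>} (\<epsilon> \<^bold>\<rightarrow> \<kappa>)" "derives S {\<epsilon>} \<alpha>"
  shows "derives S {\<alpha> \<^bold>\<rightarrow> \<beta>} (\<epsilon> \<^bold>\<rightarrow> \<kappa>)"
proof -
  have "derives S {\<epsilon> \<^bold>\<and> \<kappa>} \<alpha>" by (rule entails_trans[OF derives.ConjE1 assms(2)])
  then have "derives S {\<alpha> \<^bold>\<rightarrow> (\<epsilon> \<^bold>\<rightarrow> \<kappa>)} ((\<alpha> \<^bold>\<and> \<epsilon>) \<^bold>\<rightarrow> \<kappa>)" by (rule derives.ImpR)
  moreover have "derives S {(\<alpha> \<^bold>\<and> \<epsilon>) \<^bold>\<rightarrow> \<kappa>} (\<epsilon> \<^bold>\<rightarrow> \<kappa>)"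
    by (rule derives.Rep1[OF derives.ConjE2 entails_conj[OF assms(2) entails_refl]])
  ultimately show ?thesis using derives.Con[OF assms(1)] entails_trans by blast
qed

text \<open>
  Under the hypothesis, \<open>\<alpha> \<rightarrow> \<alpha>\<close> entails \<open>\<alpha> \<rightarrow> (\<alpha> \<rightarrow> \<beta>)\<close>, which contracts to \<open>\<alpha> \<rightarrow> \<beta>\<close>. In the
  canonical frame this says that a pair excluded by the reflexivity requirement
  rejects a theorem; no point would be open to it, so it could not serve as a counterexample to an
  implication.
\<close>

lemma imp_of_self:
  assumes "derives S {\<alpha>} (\<alpha> \<^bold>\<rightarrow> \<beta>)"
  shows "derives S {\<gamma>} (\<alpha> \<^bold>\<rightarrow> \<beta>)"
proof -
  have "derives S {\<alpha> \<^bold>\<rightarrow> \<alpha>} (\<alpha> \<^bold>\<rightarrow> \<beta>)"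
    by (rule imp_absorb[OF entails_trans[OF derives.ConjE1 assms] entails_refl])
  then show ?thesis by (rule entails_trans[OF entails_theorem[OF derives.ImpId]])
qed

text \<open>
  In \<open>SysF\<close>, \<open>\<gamma>\<close> entails \<open>\<not> \<not> \<gamma>\<close>, and \<open>\<not> \<not> \<gamma>\<close> entails \<open>\<epsilon> \<rightarrow> \<kappa>\<close> for every \<open>\<epsilon>\<close> that
  entails \<open>\<not> \<gamma>\<close>. This yields pseudosymmetry of the canonical frame.
\<close>

lemma neg_swap:
  assumes "derives SysF {\<epsilon>} (\<^bold>\<not> \<gamma>)"
  shows "derives SysF {\<gamma>} (\<epsilon> \<^bold>\<rightarrow> \<kappa>)"
proof -
  have "derives SysF {\<^bold>\<not> \<gamma> \<^bold>\<and> \<^bold>\<bottom>} (\<epsilon> \<^bold>\<rightarrow> \<kappa>)"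
    by (rule entails_trans[OF derives.ConjE2 derives.BotE])
  from imp_absorb[OF this assms] show ?thesis
    by (rule entails_trans[OF derives.NegNegI[OF refl]])
qed


section \<open>The canonical frame of a set of formulas\<close>

definition heads :: "form set \<Rightarrow> form set"
  where "heads F = F \<union> (\<lambda>(\<alpha>, \<beta>). \<alpha> \<^bold>\<and> \<beta>) ` (F \<times> F)"

text \<open>
  The negated derivability makes the relation \<open>canon_rel S\<close> below reflexive on these points.
\<close>

definition canon_points :: "system \<Rightarrow> form set \<Rightarrow> (form \<times> form) set"
  where "canon_points S F = {(\<gamma>, \<kappa>) \<in> heads F \<times> F. \<not> derives S {\<gamma>} (\<gamma> \<^bold>\<rightarrow> \<kappa>)}"

definition canon_rel :: "system \<Rightarrow> form \<times> form \<Rightarrow> form \<times> form \<Rightarrow> bool"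
  where "canon_rel S y x \<longleftrightarrow> \<not> derives S {fst x} (fst y \<^bold>\<rightarrow> snd y)"

definition canon_val :: "system \<Rightarrow> nat \<Rightarrow> form \<times> form \<Rightarrow> bool"
  where "canon_val S p x \<longleftrightarrow> derives S {fst x} (Var p)"

text \<open>
  Every consistent \<open>\<gamma>\<close> occurs as the first component of a point. This supplies all the witnesses
  for which only the first component matters.
\<close>

lemma bot_point:
  assumes "\<gamma> \<in> heads F" "\<^bold>\<bottom> \<in> F" "\<not> derives S {\<gamma>} \<delta>"
  shows "(\<gamma>, \<^bold>\<bottom>) \<in> canon_points S F"
  using assms entails_contradiction unfolding canon_points_def by blast

lemma canon_frame:
  assumes "\<^bold>\<bottom> \<in> F"
  shows "frame S (canon_points S F) (canon_rel S)"
  unfolding frame_def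
proof (intro conjI ballI impI)
  fix x assume "x \<in> canon_points S F"
  then show "canon_rel S x x" by (auto simp: canon_points_def canon_rel_def)
next
  fix x y
  assume S: "S = SysF" and x: "x \<in> canon_points S F" and y: "y \<in> canon_points S F"
    and yx: "canon_rel S y x"
  \<comment> \<open>Since relations to a point depend only on its first component, \<open>?z\<close> is open to the same points as \<open>x\<close>.\<close>
  let ?z = "(fst x, \<^bold>\<bottom>)"
  have "?z \<in> canon_points S F"
    using bot_point[OF _ assms] x by (force simp: canon_points_def)
  moreover have "canon_rel S ?z y"
    using yx neg_swap[of "fst y" "fst x" "snd y"] by (auto simp: canon_rel_def S)
  ultimately show "\<exists>z\<in>canon_points S F. canon_rel S z y \<and>
      (\<forall>w\<in>canon_points S F. canon_rel S w z \<longrightarrow> canon_rel S w x)"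
    by (intro bexI[of _ ?z]) (auto simp: canon_rel_def)
qed

text \<open>
  The common core of the truth lemma for variables, disjunctions (both with \<open>\<alpha> = \<top>\<close>) and
  implications. The predicate \<open>Q\<close> may be smaller than the set of points that derive \<open>\<beta>\<close>, as it is for a
  disjunction; it suffices that, together with \<open>P\<close>, it covers \<open>\<alpha> \<and> \<beta>\<close> in the sense that no formula
  that is underivable from \<open>\<alpha> \<and> \<beta>\<close> is derivable at all its points.

  If \<open>\<alpha> \<rightarrow> \<beta>\<close> is not derivable at \<open>x\<close>, the point \<open>(\<alpha>, \<beta>)\<close> is a counterexample, because no
  point deriving \<open>\<alpha> \<and> \<beta>\<close> is open to it. Conversely, if \<open>\<alpha> \<rightarrow> \<beta>\<close> is derivable at \<open>x\<close>, then
  \<open>x\<close> could not be open to a point \<open>y\<close> that derives \<open>\<alpha>\<close> if \<open>\<alpha> \<and> \<beta>\<close> derived what \<open>y\<close> rejects, by \<open>imp_absorb\<close>.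
\<close>

lemma canon_arrow:
  assumes "\<^bold>\<bottom> \<in> F" "\<alpha> \<in> heads F" "\<beta> \<in> F" "x \<in> canon_points S F"
    and P: "\<And>y. y \<in> canon_points S F \<Longrightarrow> P y \<longleftrightarrow> derives S {fst y} \<alpha>"
    and Q: "\<And>y. y \<in> canon_points S F \<Longrightarrow> P y \<Longrightarrow> Q y \<Longrightarrow> derives S {fst y} \<beta>"
    and cover: "\<And>\<delta>. \<not> derives S {\<alpha> \<^bold>\<and> \<beta>} \<delta> \<Longrightarrow>
      \<exists>z\<in>canon_points S F. P z \<and> Q z \<and> \<not> derives S {fst z} \<delta>"
  shows "arrow (canon_points S F) (canon_rel S) P Q x \<longleftrightarrow> derives S {fst x} (\<alpha> \<^bold>\<rightarrow> \<beta>)"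
proof
  assume arr: "arrow (canon_points S F) (canon_rel S) P Q x"
  show "derives S {fst x} (\<alpha> \<^bold>\<rightarrow> \<beta>)"
  proof (rule ccontr)
    assume neg: "\<not> derives S {fst x} (\<alpha> \<^bold>\<rightarrow> \<beta>)"
    have y: "(\<alpha>, \<beta>) \<in> canon_points S F"
      using neg imp_of_self assms(2,3) unfolding canon_points_def by blast
    have "P (\<alpha>, \<beta>)" using P[OF y] entails_refl by simp
    moreover have "canon_rel S (\<alpha>, \<beta>) x" using neg by (simp add: canon_rel_def)
    ultimately obtain z where z: "z \<in> canon_points S F" "canon_rel S (\<alpha>, \<beta>) z" "P z" "Q z"
      using arr y unfolding arrow_def by blast
    have "derives S {fst z} (\<alpha> \<^bold>\<and> \<beta>)" using P Q z entails_conj by blast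
    then have "derives S {fst z} (\<alpha> \<^bold>\<rightarrow> \<beta>)" by (rule entails_trans[OF _ derives.ConjImp])
    then show False using z(2) by (simp add: canon_rel_def)
  qed
next
  assume d: "derives S {fst x} (\<alpha> \<^bold>\<rightarrow> \<beta>)"
  show "arrow (canon_points S F) (canon_rel S) P Q x"
    unfolding arrow_def
  proof (intro ballI impI)
    fix y assume y: "y \<in> canon_points S F" "canon_rel S y x" "P y"
    have "\<not> derives S {\<alpha> \<^bold>\<and> \<beta>} (fst y \<^bold>\<rightarrow> snd y)"
      using imp_absorb[of S \<alpha> \<beta> "fst y" "snd y"] P[OF y(1)] y(2,3) entails_trans[OF d]
      by (auto simp: canon_rel_def)
    from cover[OF this] show "\<exists>z\<in>canon_points S F. canon_rel S y z \<and> P z \<and> Q z"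
      by (auto simp: canon_rel_def)
  qed
qed

definition subformula_closed :: "form set \<Rightarrow> bool"
  where "subformula_closed F \<longleftrightarrow>
    (\<forall>\<alpha> \<beta>. \<alpha> \<^bold>\<and> \<beta> \<in> F \<or> \<alpha> \<^bold>\<or> \<beta> \<in> F \<or> \<alpha> \<^bold>\<rightarrow> \<beta> \<in> F \<longrightarrow> \<alpha> \<in> F \<and> \<beta> \<in> F)"

lemma truth_lemma:
  assumes F: "\<^bold>\<bottom> \<in> F" "\<^bold>\<top> \<in> F" "subformula_closed F"
    and "\<phi> \<in> F" "x \<in> canon_points S F"
  shows "sat (canon_points S F) (canon_rel S) (canon_val S) \<phi> x \<longleftrightarrow> derives S {fst x} \<phi>"
  using assms(4,5)
proof (induction \<phi> arbitrary: x)
  case (Var p)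
  have "arrow (canon_points S F) (canon_rel S) (\<lambda>_. True) (canon_val S p) x
      \<longleftrightarrow> derives S {fst x} (\<^bold>\<top> \<^bold>\<rightarrow> Var p)"
  proof (rule canon_arrow[OF F(1) _ Var])
    fix \<delta> assume "\<not> derives S {\<^bold>\<top> \<^bold>\<and> Var p} \<delta>"
    then have nd: "\<not> derives S {Var p} \<delta>" using entails_trans derives.ConjE2 by blast
    then show "\<exists>z\<in>canon_points S F. True \<and> canon_val S p z \<and> \<not> derives S {fst z} \<delta>"
      using bot_point[OF _ F(1) nd] Var(1) entails_refl
      by (intro bexI[of _ "(Var p, \<^bold>\<bottom>)"]) (auto simp: heads_def canon_val_def)
  qed (auto simp: canon_val_def heads_def F entails_theorem derives.TopI)
  then show ?case by (simp add: top_imp_iff)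
next
  case Bot
  then have "\<not> derives S {fst x} \<^bold>\<bottom>"
    using entails_trans[OF _ derives.BotE] by (auto simp: canon_points_def)
  then show ?case by simp
next
  case Top
  then show ?case by (simp add: entails_theorem derives.TopI)
next
  case (Conj \<alpha> \<beta>)
  then have ab: "\<alpha> \<in> F" "\<beta> \<in> F" using F(3) unfolding subformula_closed_def by blast+
  then show ?case
    using Conj.IH ab Conj.prems(2) entails_conj[of S "fst x" \<alpha> \<beta>]
      entails_conjD1[of S "fst x" \<alpha> \<beta>] entails_conjD2[of S "fst x" \<alpha> \<beta>]
    by auto
next
  case (Disj \<alpha> \<beta>)
  let ?sat = "sat (canon_points S F) (canon_rel S) (canon_val S)"
  have ab: "\<alpha> \<in> F" "\<beta> \<in> F" using F(3) Disj.prems(1) unfolding subformula_closed_def by blast+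
  have "arrow (canon_points S F) (canon_rel S) (\<lambda>_. True) (\<lambda>z. ?sat \<alpha> z \<or> ?sat \<beta> z) x
      \<longleftrightarrow> derives S {fst x} (\<^bold>\<top> \<^bold>\<rightarrow> \<alpha> \<^bold>\<or> \<beta>)"
  proof (rule canon_arrow[OF F(1) _ Disj.prems])
    fix y assume "y \<in> canon_points S F" "?sat \<alpha> y \<or> ?sat \<beta> y"
    then show "derives S {fst y} (\<alpha> \<^bold>\<or> \<beta>)"
      using Disj.IH ab entails_trans derives.DisjI1 derives.DisjI2 by blast
  next
    fix \<delta> assume "\<not> derives S {\<^bold>\<top> \<^bold>\<and> (\<alpha> \<^bold>\<or> \<beta>)} \<delta>"
    then have "\<not> derives S {\<alpha> \<^bold>\<or> \<beta>} \<delta>" using entails_trans derives.ConjE2 by blast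
    then obtain \<gamma> where g: "\<gamma> = \<alpha> \<or> \<gamma> = \<beta>" "\<not> derives S {\<gamma>} \<delta>" using derives.DisjE by blast
    then have pt: "(\<gamma>, \<^bold>\<bottom>) \<in> canon_points S F"
      using bot_point[OF _ F(1) g(2)] ab by (auto simp: heads_def)
    then show "\<exists>z\<in>canon_points S F. True \<and> (?sat \<alpha> z \<or> ?sat \<beta> z) \<and> \<not> derives S {fst z} \<delta>"
      using Disj.IH ab g entails_refl by (intro bexI[OF _ pt]) auto
  qed (auto simp: heads_def F entails_theorem derives.TopI)
  then show ?case by (simp add: top_imp_iff)
next
  case (Imp \<alpha> \<beta>)
  let ?sat = "sat (canon_points S F) (canon_rel S) (canon_val S)"
  have ab: "\<alpha> \<in> F" "\<beta> \<in> F" using F(3) Imp.prems(1) unfolding subformula_closed_def by blast+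
  have "arrow (canon_points S F) (canon_rel S) (?sat \<alpha>) (?sat \<beta>) x
      \<longleftrightarrow> derives S {fst x} (\<alpha> \<^bold>\<rightarrow> \<beta>)"
  proof (rule canon_arrow[OF F(1) _ ab(2) Imp.prems(2)])
    fix \<delta> assume nd: "\<not> derives S {\<alpha> \<^bold>\<and> \<beta>} \<delta>"
    have pt: "(\<alpha> \<^bold>\<and> \<beta>, \<^bold>\<bottom>) \<in> canon_points S F"
      using bot_point[OF _ F(1) nd] ab by (auto simp: heads_def)
    then show "\<exists>z\<in>canon_points S F. ?sat \<alpha> z \<and> ?sat \<beta> z \<and> \<not> derives S {fst z} \<delta>"
      using Imp.IH ab nd by (intro bexI[OF _ pt]) (auto intro: derives.ConjE1 derives.ConjE2)
  qed (use Imp.IH ab in \<open>auto simp: heads_def\<close>)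
  then show ?case by simp
qed

lemma card_heads: "finite F \<Longrightarrow> card (heads F) \<le> card F + card F * card F"
  unfolding heads_def
  by (intro order.trans[OF card_Un_le] add_mono order_refl)
    (metis card_cartesian_product card_image_le finite_cartesian_product)

text \<open>
  The countermodel is the canonical frame of \<open>F\<close>, with its points numbered; the sequent fails at
  \<open>(\<phi>, \<bottom>)\<close>.
\<close>

theorem finite_model_property:
  assumes F: "\<^bold>\<bottom> \<in> F" "\<^bold>\<top> \<in> F" "subformula_closed F" "finite F"
    and "\<phi> \<in> F" "\<psi> \<in> F" and nd: "\<not> derives S {\<phi>} \<psi>"
  shows "\<exists>n \<le> (card F + card F * card F) * card F. \<exists>R V.
    frame S {..<n} R \<and> (\<exists>x<n. sat {..<n} R V \<phi> x \<and> \<not> sat {..<n} R V \<psi> x)"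
proof -
  let ?X = "canon_points S F"
  have fin: "finite (heads F \<times> F)" using F(4) by (simp add: heads_def)
  have sub: "?X \<subseteq> heads F \<times> F" by (auto simp: canon_points_def)
  have "card ?X \<le> card (heads F \<times> F)" by (rule card_mono[OF fin sub])
  also have "\<dots> \<le> (card F + card F * card F) * card F"
    using card_heads[OF F(4)] by (simp add: card_cartesian_product)
  finally have le: "card ?X \<le> (card F + card F * card F) * card F" .
  obtain f where "bij_betw f {..<card ?X} ?X"
    using ex_bij_betw_nat_finite[OF finite_subset[OF sub fin]]
    by (auto simp: atLeast0LessThan)
  then have f: "f ` {..<card ?X} = ?X" by (simp add: bij_betw_def)
  have "(\<phi>, \<^bold>\<bottom>) \<in> ?X" using bot_point[OF _ F(1) nd] assms(5) by (auto simp: heads_def)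
  then obtain x where x: "x < card ?X" "f x = (\<phi>, \<^bold>\<bottom>)" using f by (metis imageE lessThan_iff)
  then have "f x \<in> ?X" using f by blast
  from truth_lemma[OF F(1-3) _ this] have
    "sat ?X (canon_rel S) (canon_val S) \<phi> (f x) \<and> \<not> sat ?X (canon_rel S) (canon_val S) \<psi> (f x)"
    using assms(5,6) nd x(2) entails_refl by simp
  then show ?thesis
    using le frame_pullback[OF f canon_frame[OF F(1)]] sat_pullback[OF f] x(1)
    by (metis lessThan_iff)
qed

section \<open>Total recursive functions and decidable predicates of tuples\<close>

text \<open>
  The argument list is an environment: a bounded quantifier or a recursion pushes its variables on
  the front of the list, and a variable is referred to by \<open>hd\<close> and \<open>tl\<close>. So predicates can be
  written in ordinary notation, and their decidability follows by backward reasoning on their form.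
\<close>

definition computable :: "nat \<Rightarrow> (nat list \<Rightarrow> nat) \<Rightarrow> bool"
  where "computable n f \<longleftrightarrow> (\<exists>r. \<forall>xs. length xs = n \<longrightarrow> evaluates r xs (f xs))"

lemma computable_cong:
  "computable n f \<Longrightarrow> (\<And>xs. length xs = n \<Longrightarrow> f xs = g xs) \<Longrightarrow> computable n g"
  unfolding computable_def by simp

lemma computable_nth: "i < n \<Longrightarrow> computable n (\<lambda>xs. xs ! i)"
  unfolding computable_def by (intro exI[of _ "Proj i"]) (auto intro: evaluates.Proj)

lemma computable_comp:
  assumes "computable (length gs) f" "\<And>g. g \<in> set gs \<Longrightarrow> computable n g"
  shows "computable n (\<lambda>xs. f (map (\<lambda>g. g xs) gs))"
proof -
  obtain r where r: "\<And>ys. length ys = length gs \<Longrightarrow> evaluates r ys (f ys)"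
    using assms(1) unfolding computable_def by blast
  obtain c where c: "\<And>g xs. g \<in> set gs \<Longrightarrow> length xs = n \<Longrightarrow> evaluates (c g) xs (g xs)"
    using assms(2) unfolding computable_def by metis
  have "evaluates (Comp r (map c gs)) xs (f (map (\<lambda>g. g xs) gs))" if "length xs = n" for xs
    by (rule evaluates.Comp[where ys = "map (\<lambda>g. g xs) gs"])
      (auto simp: list_all2_conv_all_nth that intro!: c r)
  then show ?thesis unfolding computable_def by blast
qed

text \<open>
  Rearrangement of the argument list, with some computed values placed in front.
\<close>

lemma computable_select:
  assumes "computable (length gs + length js) f"
    and "\<And>g. g \<in> set gs \<Longrightarrow> computable n g" "\<And>j. j \<in> set js \<Longrightarrow> j < n"
  shows "computable n (\<lambda>xs. f (map (\<lambda>g. g xs) gs @ map ((!) xs) js))"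
proof -
  have "computable n (\<lambda>xs. f (map (\<lambda>g. g xs) (gs @ map (\<lambda>j xs. xs ! j) js)))"
    by (rule computable_comp) (use assms in \<open>auto intro: computable_nth\<close>)
  then show ?thesis by (simp add: comp_def)
qed

lemma map_nth_drop: "length xs = n \<Longrightarrow> map ((!) xs) [d..<n] = drop d xs"
  by (auto intro: nth_equalityI)

lemma computable_tl:
  assumes "computable n f"
  shows "computable (Suc n) (\<lambda>xs. f (tl xs))"
proof -
  have "computable (Suc n) (\<lambda>xs. f (map (\<lambda>g. g xs) [] @ map ((!) xs) [1..<Suc n]))"
    by (rule computable_select) (use assms in \<open>auto simp del: upt_Suc\<close>)
  then show ?thesis
    by (rule computable_cong) (simp add: map_nth_drop drop_Suc del: upt_Suc)
qed

lemma computable_const: "computable n (\<lambda>_. c)"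
proof (induction c)
  case 0
  show ?case unfolding computable_def by (blast intro: evaluates.Zero)
next
  case (Suc c)
  have "computable (length [\<lambda>_::nat list. c]) (\<lambda>ys. Suc (hd ys))"
    unfolding computable_def
    by (intro exI[of _ recf.Succ]) (auto simp: length_Suc_conv intro: evaluates.Succ)
  from computable_comp[OF this, of n] Suc show ?case by simp
qed

lemma computable_Suc: "computable n f \<Longrightarrow> computable n (\<lambda>xs. Suc (f xs))"
proof -
  assume f: "computable n f"
  have "computable (length [f]) (\<lambda>ys. Suc (hd ys))"
    unfolding computable_def
    by (intro exI[of _ recf.Succ]) (auto simp: length_Suc_conv intro: evaluates.Succ)
  from computable_comp[OF this, of n] f show ?thesis by simp
qed

lemma computable_hd: "computable (Suc n) (\<lambda>xs. hd xs)"
  by (rule computable_cong[OF computable_nth[of 0 "Suc n"]]) (auto simp: length_Suc_conv)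

text \<open>
  An instance of \<open>computable_tl\<close> whose shape restricts it to projections. Unlike the general
  statement it can be used freely in backward reasoning, where it brings every
  projection \<open>hd (tl (\<dots> xs))\<close> down to \<open>computable_hd\<close>.
\<close>

lemma computable_hd_tl:
  "computable n (\<lambda>xs. hd (g xs)) \<Longrightarrow> computable (Suc n) (\<lambda>xs. hd (g (tl xs)))"
  by (rule computable_tl)

lemma computable_rec_nat:
  assumes f: "computable n f"
    and g: "computable (Suc (Suc n)) (\<lambda>ys. g (tl (tl ys)) (hd ys) (hd (tl ys)))"
    and t: "computable n t"
  shows "computable n (\<lambda>xs. rec_nat (f xs) (g xs) (t xs))"
proof -
  obtain rf where rf: "\<And>xs. length xs = n \<Longrightarrow> evaluates rf xs (f xs)"
    using f unfolding computable_def by blast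
  obtain rg where rg: "\<And>ys. length ys = Suc (Suc n) \<Longrightarrow>
      evaluates rg ys (g (tl (tl ys)) (hd ys) (hd (tl ys)))"
    using g unfolding computable_def by blast
  have "evaluates (PrimRec rf rg) (m # xs) (rec_nat (f xs) (g xs) m)" if "length xs = n" for m xs
  proof (induction m)
    case 0
    show ?case using rf[OF that] by (simp add: evaluates.PrimRec_0)
  next
    case (Suc m)
    from evaluates.PrimRec_Suc[OF this] rg[of "m # _ # xs"] that show ?case by simp
  qed
  then have pr: "computable (Suc n) (\<lambda>ys. rec_nat (f (tl ys)) (g (tl ys)) (hd ys))"
    unfolding computable_def
    by (intro exI[of _ "PrimRec rf rg"]) (auto simp: length_Suc_conv)
  have "computable n (\<lambda>xs. (\<lambda>ys. rec_nat (f (tl ys)) (g (tl ys)) (hd ys))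
      (map (\<lambda>h. h xs) [t] @ map ((!) xs) [0..<n]))"
    by (rule computable_select) (use pr t in auto)
  then show ?thesis by (rule computable_cong) (simp add: map_nth_drop)
qed

lemma computable_add:
  assumes "computable n f" "computable n g"
  shows "computable n (\<lambda>xs. f xs + g xs)"
proof -
  have "computable n (\<lambda>xs. rec_nat (g xs) (\<lambda>_ r. Suc r) (f xs))"
    by (intro computable_rec_nat computable_Suc computable_hd_tl computable_hd assms)
  moreover have "rec_nat b (\<lambda>_ r. Suc r) a = a + b" for a b :: nat by (induction a) auto
  ultimately show ?thesis by simp
qed

lemma computable_mult:
  assumes "computable n f" "computable n g"
  shows "computable n (\<lambda>xs. f xs * g xs)"
proof -
  have "computable n (\<lambda>xs. rec_nat 0 (\<lambda>_ r. g xs + r) (f xs))"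
    by (intro computable_rec_nat computable_const computable_add computable_hd_tl computable_hd
        computable_tl assms)
  moreover have "rec_nat 0 (\<lambda>_ r. b + r) a = a * b" for a b :: nat by (induction a) auto
  ultimately show ?thesis by simp
qed

lemma computable_power2:
  assumes "computable n f"
  shows "computable n (\<lambda>xs. 2 ^ f xs)"
proof -
  have "computable n (\<lambda>xs. rec_nat 1 (\<lambda>_ r. 2 * r) (f xs))"
    by (intro computable_rec_nat computable_const computable_mult computable_hd_tl computable_hd assms)
  moreover have "rec_nat (Suc 0) (\<lambda>_ r. 2 * r) a = (2 :: nat) ^ a" for a by (induction a) auto
  ultimately show ?thesis by simp
qed

lemma computable_prod_encode:
  assumes "computable n f" "computable n g"
  shows "computable n (\<lambda>xs. prod_encode (f xs, g xs))"
proof -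
  have "computable n (\<lambda>xs. rec_nat 0 (\<lambda>i r. r + Suc i) (f xs + g xs) + f xs)"
    by (intro computable_rec_nat computable_const computable_add computable_Suc
        computable_hd_tl computable_hd assms)
  moreover have "rec_nat 0 (\<lambda>i r. r + Suc i) a = triangle a" for a :: nat
    by (induction a) (auto simp: triangle_Suc)
  ultimately show ?thesis by (simp add: prod_encode_def)
qed

definition decides :: "nat \<Rightarrow> (nat list \<Rightarrow> bool) \<Rightarrow> bool"
  where "decides n P \<longleftrightarrow> computable n (\<lambda>xs. if P xs then 1 else 0)"

lemma decides_const: "decides n (\<lambda>_. b)"
  unfolding decides_def by (rule computable_const)

lemma decides_zero:
  assumes "computable n f"
  shows "decides n (\<lambda>xs. f xs = 0)"
proof -
  have "computable n (\<lambda>xs. rec_nat 1 (\<lambda>_ _. 0) (f xs))"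
    by (intro computable_rec_nat computable_const assms)
  then show ?thesis
    unfolding decides_def by (rule computable_cong) (auto split: nat.split simp: gr0_conv_Suc)
qed

lemma decides_not:
  assumes "decides n P"
  shows "decides n (\<lambda>xs. \<not> P xs)"
proof -
  have "(\<lambda>xs. (if P xs then 1 else 0 :: nat) = 0) = (\<lambda>xs. \<not> P xs)" by auto
  then show ?thesis using decides_zero[OF assms[unfolded decides_def]] by metis
qed

lemma decides_and:
  assumes "decides n P" "decides n Q"
  shows "decides n (\<lambda>xs. P xs \<and> Q xs)"
  unfolding decides_def
  by (rule computable_cong[OF computable_mult[OF assms[unfolded decides_def]]]) auto

lemma decides_or:
  assumes "decides n P" "decides n Q"
  shows "decides n (\<lambda>xs. P xs \<or> Q xs)"
  using decides_not[OF decides_and[OF assms[THEN decides_not]]] by simp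

lemma decides_imp:
  assumes "decides n P" "decides n Q"
  shows "decides n (\<lambda>xs. P xs \<longrightarrow> Q xs)"
  using decides_or[OF decides_not[OF assms(1)] assms(2)] unfolding imp_conv_disj .

lemma decides_iff:
  assumes "decides n P" "decides n Q"
  shows "decides n (\<lambda>xs. P xs \<longleftrightarrow> Q xs)"
  using decides_and[OF decides_imp[OF assms] decides_imp[OF assms(2,1)]]
  unfolding iff_conv_conj_imp .

lemma decides_le:
  assumes "computable n f" "computable n g"
  shows "decides n (\<lambda>xs. f xs \<le> g xs)"
proof -
  have pred: "computable m (\<lambda>xs. h xs - 1)" if "computable m h" for m h
  proof -
    have "computable m (\<lambda>xs. rec_nat 0 (\<lambda>i _. i) (h xs))"
      by (intro computable_rec_nat computable_const computable_hd that)
    moreover have "rec_nat 0 (\<lambda>i _. i) a = a - 1" for a :: nat by (cases a) auto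
    ultimately show ?thesis by simp
  qed
  have "computable n (\<lambda>xs. rec_nat (f xs) (\<lambda>_ r. r - 1) (g xs))"
    by (intro computable_rec_nat pred computable_hd_tl computable_hd assms)
  moreover have "rec_nat a (\<lambda>_ r. r - 1) b = a - b" for a b :: nat by (induction b) auto
  ultimately have "computable n (\<lambda>xs. f xs - g xs)" by simp
  from decides_zero[OF this] show ?thesis by simp
qed

lemma decides_eq:
  assumes "computable n f" "computable n g"
  shows "decides n (\<lambda>xs. f xs = g xs)"
  using decides_and[OF decides_le[OF assms] decides_le[OF assms(2,1)]]
  unfolding eq_iff[symmetric] .

text \<open>
  The bounded universal quantifier is a product of truth values, computed by primitive
  recursion on the bound.
\<close>

lemma decides_ball:
  assumes Q: "decides (Suc n) (\<lambda>xs. Q (tl xs) (hd xs))" and t: "computable n t"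
  shows "decides n (\<lambda>xs. \<forall>i\<in>{..<t xs}. Q xs i)"
proof -
  let ?q = "\<lambda>xs i. if Q xs i then 1 else (0::nat)"
  let ?g = "\<lambda>xs i r. ?q xs i * r"
  have "computable (Suc (Suc n)) (\<lambda>xs. (\<lambda>ys. ?q (tl ys) (hd ys))
      (map (\<lambda>h. h xs) [\<lambda>xs. hd xs] @ map ((!) xs) [2..<Suc (Suc n)]))"
    by (rule computable_select)
      (use Q in \<open>auto simp: decides_def simp del: upt_Suc intro: computable_hd\<close>)
  then have q: "computable (Suc (Suc n)) (\<lambda>xs. ?q (tl (tl xs)) (hd xs))"
    by (rule computable_cong)
      (simp add: map_nth_drop drop_Suc numeral_2_eq_2 del: upt_Suc)
  have "computable n (\<lambda>xs. rec_nat 1 (?g xs) (t xs))"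
    by (intro computable_rec_nat computable_const computable_mult q computable_hd_tl
        computable_hd t)
  moreover have "rec_nat 1 (?g xs) m = (if \<forall>i\<in>{..<m}. Q xs i then 1 else 0)" for xs m
    by (induction m) (auto simp: less_Suc_eq)
  ultimately show ?thesis unfolding decides_def by simp
qed

lemma decides_bex:
  assumes Q: "decides (Suc n) (\<lambda>xs. Q (tl xs) (hd xs))" and t: "computable n t"
  shows "decides n (\<lambda>xs. \<exists>i\<in>{..<t xs}. Q xs i)"
  using decides_not[OF decides_ball[OF decides_not[OF Q] t]] by simp

text \<open>
  The binary digit of \<open>s\<close> at position \<open>m\<close> is 1, written with bounded quantifiers only.
\<close>

lemma mem_set_decode_iff:
  "m \<in> set_decode s \<longleftrightarrow> (\<exists>q\<in>{..<Suc s}. \<exists>r\<in>{..<2 ^ m}. s = (2 * q + 1) * 2 ^ m + r)"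
proof
  assume "m \<in> set_decode s"
  then have "odd (s div 2 ^ m)" by (simp add: set_decode_def)
  then obtain q where q: "s div 2 ^ m = 2 * q + 1" by (elim oddE)
  have "s = (2 * q + 1) * 2 ^ m + s mod 2 ^ m" using div_mult_mod_eq[of s "2 ^ m"] q by simp
  moreover have "q < Suc s" using q div_le_dividend[of s "2 ^ m"] by linarith
  ultimately show "\<exists>q\<in>{..<Suc s}. \<exists>r\<in>{..<2 ^ m}. s = (2 * q + 1) * 2 ^ m + r" by force
next
  assume "\<exists>q\<in>{..<Suc s}. \<exists>r\<in>{..<2 ^ m}. s = (2 * q + 1) * 2 ^ m + r"
  then obtain q r where "r < 2 ^ m" "s = (2 * q + 1) * 2 ^ m + r" by blast
  then have "s div 2 ^ m = 2 * q + 1" by (simp add: div_nat_eqI algebra_simps)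
  then show "m \<in> set_decode s" by (simp add: set_decode_def)
qed

lemma decides_mem:
  assumes "computable n f" "computable n g"
  shows "decides n (\<lambda>xs. f xs \<in> set_decode (g xs))"
  unfolding mem_set_decode_iff
  by (intro decides_bex decides_eq computable_add computable_mult computable_const
      computable_power2 computable_hd_tl computable_hd computable_tl computable_Suc assms)

lemmas computable_intros =
  computable_hd computable_hd_tl computable_const computable_add computable_mult
  computable_power2 computable_prod_encode computable_Suc
lemmas decides_intros =
  decides_const decides_not decides_and decides_or decides_imp decides_iff
  decides_eq decides_ball decides_bex decides_mem


section \<open>Coded finite models\<close>

text \<open>
  The recursive clauses of \<open>sat\<close>, restricted to formulas with code below \<open>L\<close> and stated for their
  codes: the three sums \<open>4 * prod_encode (i, j) + c\<close> are those in the definition of \<open>code\<close>.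
  The first clause demands closedness for every code, which for variables is the only demand.
\<close>

definition truth_table :: "nat \<Rightarrow> 'w set \<Rightarrow> ('w \<Rightarrow> 'w \<Rightarrow> bool) \<Rightarrow> (nat \<Rightarrow> 'w \<Rightarrow> bool) \<Rightarrow> bool"
  where "truth_table L X R T \<longleftrightarrow> (\<forall>k\<in>{..<L}. \<forall>x\<in>X.
    (arrow X R (\<lambda>_. True) (T k) x \<longleftrightarrow> T k x) \<and>
    (k = 0 \<longrightarrow> \<not> T k x) \<and> (k = 1 \<longrightarrow> T k x) \<and>
    (\<forall>i\<in>{..<k}. \<forall>j\<in>{..<k}.
      (k = 4 * prod_encode (i, j) + 3 \<longrightarrow> (T k x \<longleftrightarrow> T i x \<and> T j x)) \<and>
      (k = 4 * prod_encode (i, j) + 4 \<longrightarrow>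
        (T k x \<longleftrightarrow> arrow X R (\<lambda>_. True) (\<lambda>z. T i z \<or> T j z) x)) \<and>
      (k = 4 * prod_encode (i, j) + 5 \<longrightarrow> (T k x \<longleftrightarrow> arrow X R (T i) (T j) x))))"

lemma code_args_less:
  "c > 0 \<Longrightarrow> a < 4 * prod_encode (a, b) + c" "c > 0 \<Longrightarrow> b < 4 * prod_encode (a, b) + c"
  using le_prod_encode_1[of a b] le_prod_encode_2[of b a] by auto

lemma subformula_closed_code_less: "subformula_closed {\<gamma>. code \<gamma> < L}"
proof -
  have "a < L \<and> b < L" if "4 * prod_encode (a, b) + c < L" "c > 0" for a b c
    using code_args_less that by (metis less_trans)
  from this[where c = 3] this[where c = 4] this[where c = 5] show ?thesis
    unfolding subformula_closed_def mem_Collect_eq code.simps by (meson zero_less_numeral)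
qed

lemma arrow_cong:
  assumes "\<And>u v. u \<in> X \<Longrightarrow> v \<in> X \<Longrightarrow> R u v \<longleftrightarrow> R' u v"
    and "\<And>u. u \<in> X \<Longrightarrow> P u \<longleftrightarrow> P' u" "\<And>u. u \<in> X \<Longrightarrow> Q u \<longleftrightarrow> Q' u" "x \<in> X"
  shows "arrow X R P Q x \<longleftrightarrow> arrow X R' P' Q' x"
  unfolding arrow_def using assms by simp

lemma truth_table_cong:
  assumes "\<And>u v. u \<in> X \<Longrightarrow> v \<in> X \<Longrightarrow> R u v \<longleftrightarrow> R' u v"
    and "\<And>k u. k < L \<Longrightarrow> u \<in> X \<Longrightarrow> T k u \<longleftrightarrow> T' k u"
  shows "truth_table L X R T \<longleftrightarrow> truth_table L X R' T'"
proof -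
  have 1: "arrow X R (\<lambda>_. True) (T k) x \<longleftrightarrow> arrow X R' (\<lambda>_. True) (T' k) x"
    if "k < L" "x \<in> X" for k x
    by (rule arrow_cong) (use that assms in auto)
  have 2: "arrow X R (\<lambda>_. True) (\<lambda>z. T i z \<or> T j z) x
      \<longleftrightarrow> arrow X R' (\<lambda>_. True) (\<lambda>z. T' i z \<or> T' j z) x" if "i < L" "j < L" "x \<in> X" for i j x
    by (rule arrow_cong) (use that assms in auto)
  have 3: "arrow X R (T i) (T j) x \<longleftrightarrow> arrow X R' (T' i) (T' j) x"
    if "i < L" "j < L" "x \<in> X" for i j x
    by (rule arrow_cong) (use that assms in auto)
  show ?thesis
    unfolding truth_table_def
    by (intro ball_cong refl) (auto simp: 1 2 3 assms(2))
qed

lemma truth_table_sat: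
  assumes "frame S X R"
  shows "truth_table L X R (\<lambda>k. sat X R V (inv code k))"
proof -
  have c: "inv code (code \<phi>) = \<phi>" for \<phi> by (simp add: inv_f_f inj_code)
  have cc: "inv code (4 * prod_encode (i, j) + 3) = inv code i \<^bold>\<and> inv code j"
    "inv code (4 * prod_encode (i, j) + 4) = inv code i \<^bold>\<or> inv code j"
    "inv code (4 * prod_encode (i, j) + 5) = inv code i \<^bold>\<rightarrow> inv code j" for i j
    using c[of "inv code i \<^bold>\<and> inv code j"] c[of "inv code i \<^bold>\<or> inv code j"]
      c[of "inv code i \<^bold>\<rightarrow> inv code j"]
    by (simp_all add: surj_f_inv_f[OF surj_code])
  have "inv code 0 = \<^bold>\<bottom>" "inv code 1 = \<^bold>\<top>" using c[of "\<^bold>\<bottom>"] c[of "\<^bold>\<top>"] by simp_all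
  then show ?thesis
    unfolding truth_table_def
    by (intro ballI conjI impI) (simp_all only: cc sat.simps sat_iff_closed[OF assms] not_False_eq_True)
qed

lemma truth_table_compound:
  assumes "truth_table L X R T" "x \<in> X"
  shows
    "code (\<alpha> \<^bold>\<and> \<beta>) < L \<Longrightarrow>
      T (code (\<alpha> \<^bold>\<and> \<beta>)) x \<longleftrightarrow> T (code \<alpha>) x \<and> T (code \<beta>) x"
    "code (\<alpha> \<^bold>\<or> \<beta>) < L \<Longrightarrow>
      T (code (\<alpha> \<^bold>\<or> \<beta>)) x \<longleftrightarrow> arrow X R (\<lambda>_. True) (\<lambda>z. T (code \<alpha>) z \<or> T (code \<beta>) z) x"
    "code (\<alpha> \<^bold>\<rightarrow> \<beta>) < L \<Longrightarrow>
      T (code (\<alpha> \<^bold>\<rightarrow> \<beta>)) x \<longleftrightarrow> arrow X R (T (code \<alpha>)) (T (code \<beta>)) x"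
  using assms code_args_less unfolding truth_table_def by simp_all

lemma sat_of_truth_table:
  assumes tt: "truth_table L X R T" and "code \<phi> < L" "x \<in> X"
  shows "sat X R (\<lambda>p. T (code (Var p))) \<phi> x \<longleftrightarrow> T (code \<phi>) x"
  using assms(2,3)
proof (induction \<phi> arbitrary: x)
  case (Var p)
  then show ?case using tt unfolding truth_table_def by simp
next
  case Bot
  then show ?case using tt unfolding truth_table_def by force
next
  case Top
  then show ?case using tt unfolding truth_table_def by force
next
  case (Conj \<alpha> \<beta>)
  have small: "code \<alpha> < L" "code \<beta> < L"
    using subformula_closed_code_less[of L] Conj.prems(1) unfolding subformula_closed_def by blast+
  with Conj show ?case using truth_table_compound(1)[OF tt Conj.prems(2,1)] by simp
next
  case (Disj \<alpha> \<beta>)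
  have small: "code \<alpha> < L" "code \<beta> < L"
    using subformula_closed_code_less[of L] Disj.prems(1) unfolding subformula_closed_def by blast+
  let ?sat = "sat X R (\<lambda>p. T (code (Var p)))"
  have "arrow X R (\<lambda>_. True) (\<lambda>z. ?sat \<alpha> z \<or> ?sat \<beta> z) x
      \<longleftrightarrow> arrow X R (\<lambda>_. True) (\<lambda>z. T (code \<alpha>) z \<or> T (code \<beta>) z) x"
    by (rule arrow_cong)
      (use Disj small in auto)
  then show ?case using truth_table_compound(2)[OF tt Disj.prems(2,1)] by simp
next
  case (Imp \<alpha> \<beta>)
  have small: "code \<alpha> < L" "code \<beta> < L"
    using subformula_closed_code_less[of L] Imp.prems(1) unfolding subformula_closed_def by blast+
  let ?sat = "sat X R (\<lambda>p. T (code (Var p)))"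
  have "arrow X R (?sat \<alpha>) (?sat \<beta>) x \<longleftrightarrow> arrow X R (T (code \<alpha>)) (T (code \<beta>)) x"
    by (rule arrow_cong)
      (use Imp small in auto)
  then show ?case using truth_table_compound(3)[OF tt Imp.prems(2,1)] by simp
qed

text \<open>
  The pairs \<open>(i, j)\<close> are listed in lexicographic order, as \<open>n * i + j\<close>, and the relation is
  coded by the binary digits at these positions.
\<close>

lemma relation_code:
  fixes P :: "nat \<Rightarrow> nat \<Rightarrow> bool"
  obtains s where "s < 2 ^ (m * n)"
    "\<And>i j. i < m \<Longrightarrow> j < n \<Longrightarrow> n * i + j \<in> set_decode s \<longleftrightarrow> P i j"
proof -
  let ?A = "{k. k < m * n \<and> P (k div n) (k mod n)}"
  have "set_encode ?A \<le> set_encode {..<m * n}"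
    unfolding set_encode_def by (rule sum_mono2) auto
  also have "\<dots> < 2 ^ (m * n)"
    by (simp add: set_encode_def sum_power2 flip: atLeast0LessThan)
  finally have "set_encode ?A < 2 ^ (m * n)" .
  moreover have "n * i + j \<in> set_decode (set_encode ?A) \<longleftrightarrow> P i j" if "i < m" "j < n" for i j
  proof -
    have "n * i + j < n * Suc i" using that by simp
    also have "\<dots> \<le> n * m" using that by (intro mult_le_mono2) simp
    finally have "n * i + j < m * n" by (simp add: mult.commute)
    then show ?thesis using that by (simp add: set_encode_inverse)
  qed
  ultimately show ?thesis by (rule that)
qed

definition coded_countermodel :: "system \<Rightarrow> nat \<Rightarrow> nat \<Rightarrow> nat \<Rightarrow> nat \<Rightarrow> nat \<Rightarrow> nat \<Rightarrow> bool"
  where "coded_countermodel S L a b n r t \<longleftrightarrow>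
    frame S {..<n} (\<lambda>x y. n * x + y \<in> set_decode r) \<and>
    truth_table L {..<n} (\<lambda>x y. n * x + y \<in> set_decode r) (\<lambda>k x. n * k + x \<in> set_decode t) \<and>
    (\<exists>x\<in>{..<n}. n * a + x \<in> set_decode t \<and> \<not> n * b + x \<in> set_decode t)"

text \<open>
  The bound \<open>L\<close> exceeds the codes of both formulas and also the codes 0 and 1 of \<open>\<bottom>\<close> and \<open>\<top>\<close>.
  As every number is the code of exactly one formula, exactly \<open>L\<close> formulas have a code below
  \<open>L\<close>, which turns the bound of \<open>finite_model_property\<close> into a polynomial in \<open>L\<close>.
\<close>

lemma derives_iff_no_coded_countermodel:
  fixes \<phi> \<psi> :: form
  defines "L \<equiv> code \<phi> + code \<psi> + 2"
  shows "derives S {\<phi>} \<psi> \<longleftrightarrow> \<not> (\<exists>n\<in>{..<Suc ((L + L * L) * L)}.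
    \<exists>r\<in>{..<2 ^ (n * n)}. \<exists>t\<in>{..<2 ^ (L * n)}. coded_countermodel S L (code \<phi>) (code \<psi>) n r t)"
    (is "_ \<longleftrightarrow> \<not> ?C")
proof
  assume d: "derives S {\<phi>} \<psi>"
  show "\<not> ?C"
  proof
    assume ?C
    then obtain n r t where c: "coded_countermodel S L (code \<phi>) (code \<psi>) n r t" by blast
    let ?R = "\<lambda>x y. n * x + y \<in> set_decode r"
    let ?T = "\<lambda>k x. n * k + x \<in> set_decode t"
    let ?sat = "sat {..<n} ?R (\<lambda>p. ?T (code (Var p)))"
    from c obtain x where fr: "frame S {..<n} ?R" and tt: "truth_table L {..<n} ?R ?T"
      and x: "x \<in> {..<n}" "?T (code \<phi>) x" "\<not> ?T (code \<psi>) x"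
      unfolding coded_countermodel_def by blast
    have "?sat \<phi> x" using sat_of_truth_table[OF tt _ x(1)] x(2) by (simp add: L_def)
    then have "?sat \<psi> x" using soundness[OF d fr x(1)] by simp
    then show False using sat_of_truth_table[OF tt _ x(1)] x(3) by (simp add: L_def)
  qed
next
  let ?F = "{\<gamma>. code \<gamma> < L}"
  have im: "code ` ?F = {..<L}" using surj_code by (fastforce simp: surj_def)
  have inj: "inj_on code ?F" by (rule inj_on_subset[OF inj_code subset_UNIV])
  have card: "card ?F = L" using card_image[OF inj] unfolding im by simp
  have fin: "finite ?F" using finite_image_iff[OF inj] unfolding im by simp
  have sub: "subformula_closed ?F" by (rule subformula_closed_code_less)
  assume "\<not> ?C"
  show "derives S {\<phi>} \<psi>"
  proof (rule ccontr)
    assume "\<not> derives S {\<phi>} \<psi>"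
    then obtain n R V x where n: "n \<le> (L + L * L) * L" and fr: "frame S {..<n} R"
      and x: "x < n" "sat {..<n} R V \<phi> x" "\<not> sat {..<n} R V \<psi> x"
      using finite_model_property[of ?F \<phi> \<psi> S] sub fin card by (auto simp: L_def)
    let ?T = "\<lambda>k. sat {..<n} R V (inv code k)"
    obtain r where r: "r < 2 ^ (n * n)"
      "\<And>u v. u < n \<Longrightarrow> v < n \<Longrightarrow> n * u + v \<in> set_decode r \<longleftrightarrow> R u v"
      using relation_code[of n n R] by metis
    obtain t where t: "t < 2 ^ (L * n)"
      "\<And>k u. k < L \<Longrightarrow> u < n \<Longrightarrow> n * k + u \<in> set_decode t \<longleftrightarrow> ?T k u"
      using relation_code[of L n ?T] by metis
    have "frame S {..<n} (\<lambda>x y. n * x + y \<in> set_decode r)"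
      using fr r(2) unfolding frame_def by simp
    moreover have "truth_table L {..<n} (\<lambda>x y. n * x + y \<in> set_decode r)
        (\<lambda>k x. n * k + x \<in> set_decode t)"
      using truth_table_sat[OF fr, of L V] r(2) t(2) by (subst truth_table_cong) auto
    moreover have "n * code \<phi> + x \<in> set_decode t" "n * code \<psi> + x \<notin> set_decode t"
      using t(2)[of _ x] x by (auto simp: L_def inj_code)
    ultimately have "coded_countermodel S L (code \<phi>) (code \<psi>) n r t"
      unfolding coded_countermodel_def using x(1) by blast
    then show False using \<open>\<not> ?C\<close> n r(1) t(1) by force
  qed
qed

lemma decides_coded_countermodel:
  assumes "computable m L" "computable m a" "computable m b" "computable m n"
    "computable m r" "computable m t"
  shows "decides m (\<lambda>xs. coded_countermodel S (L xs) (a xs) (b xs) (n xs) (r xs) (t xs))"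
  unfolding coded_countermodel_def truth_table_def frame_def arrow_def
  by (intro decides_intros computable_intros computable_tl assms)

theorem corollary6p11:
  fixes S :: system
  shows "decidable {(\<phi>, \<psi>). {\<phi>} \<turnstile>\<^bsub>S\<^esub> \<psi>}"
proof -
  let ?L = "\<lambda>xs. hd xs + hd (tl xs) + 2"
  have "decides (Suc (Suc 0)) (\<lambda>xs. \<not> (\<exists>n\<in>{..<Suc ((?L xs + ?L xs * ?L xs) * ?L xs)}.
    \<exists>r\<in>{..<2 ^ (n * n)}. \<exists>t\<in>{..<2 ^ (?L xs * n)}.
      coded_countermodel S (?L xs) (hd xs) (hd (tl xs)) n r t))"
    by (intro decides_intros computable_intros decides_coded_countermodel)
  then obtain f where f: "\<And>xs. length xs = Suc (Suc 0) \<Longrightarrow> evaluates f xs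
     (if \<not> (\<exists>n\<in>{..<Suc ((?L xs + ?L xs * ?L xs) * ?L xs)}.
    \<exists>r\<in>{..<2 ^ (n * n)}. \<exists>t\<in>{..<2 ^ (?L xs * n)}.
      coded_countermodel S (?L xs) (hd xs) (hd (tl xs)) n r t) then 1 else 0)"
    unfolding decides_def computable_def by blast
  have "evaluates f [code \<phi>, code \<psi>] (if (\<phi>, \<psi>) \<in> {(\<phi>, \<psi>). {\<phi>} \<turnstile>\<^bsub>S\<^esub> \<psi>} then 1 else 0)"
    for \<phi> \<psi>
    using f[of "[code \<phi>, code \<psi>]"] by (simp only: derives_iff_no_coded_countermodel
        list.sel list.size mem_Collect_eq case_prod_conv add_0_right add_Suc_right)
  then show ?thesis unfolding decidable_def by blast
qed

end
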